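(* Let $d\ge 1$ and let $X^{d-1}$ be an $n$-vertex stacked $(d-1)$-sphere. Then there exists a sequence $X^{d-1}\subset X^{d}\subset\cdots\subset X^{n-2}=S^{n-2}_n$ of $n$-vertex stacked spheres, of dimensions $d-1,d,\dots,n-2$ respectively, each a subcomplex of the next, where $S^{n-2}_n$ is the standard $(n-2)$-sphere on the $n$ vertices of $X^{d-1}$.
   Context: Simplicial complexes are finite and abstract; isomorphic complexes are identified. An $n$-vertex complex is one with exactly $n$ vertices. The standard $k$-sphere $S^k_{k+2}$ is the boundary complex of a $(k+1)$-simplex (so it has $k+2$ vertices). A complex is pure if all its maximal faces have the same dimension; in a pure $k$-dimensional complex, faces of dimension $k$ are facets and faces of dimension $k-1$ are ridges. For a face $\sigma$, $\overline{\sigma}$ denotes the complex consisting of $\sigma$ and all its faces. A standard $k$-ball is a complex $\overline{\sigma}$ with $\sigma$ a $k$-simplex. A simplicial complex $B$ is a stacked $k$-ball if there is a sequence $B_1,\dots,B_m$ of pure simplicial complexes such that $B_1$ is a standard $k$-ball, $B_m=B$ and, for $2\le i\le m$, $B_i=B_{i-1}\cup\overline{\sigma}_i$ and $B_{i-1}\cap\overline{\sigma}_i=\overline{\tau}_i$, where $\sigma_i$ is a facet of $B_i$ and $\tau_i$ is a ridge of $B_i$ that lies in exactly one facet of $B_{i-1}$. The boundary of a stacked $k$-ball $B$ is the pure $(k-1)$-dimensional complex whose facets are the ridges of $B$ lying in exactly one facet of $B$. A stacked $k$-sphere is a complex isomorphic to the boundary of a stacked $(k+1)$-ball. *)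

theory Defs imports Main begin

text \<open>A finite abstract simplicial complex is represented by the set of all its faces, including
  the empty face (of dimension \<open>-1\<close>). Hence \<open>Pow \<sigma>\<close> is the complex consisting of \<open>\<sigma>\<close> and all its
  faces.\<close>

definition simplicial_complex :: "'a set set \<Rightarrow> bool" where
  "simplicial_complex K \<longleftrightarrow>
     finite K \<and> {} \<in> K \<and> (\<forall>\<sigma>\<in>K. finite \<sigma>) \<and> (\<forall>\<sigma>\<in>K. \<forall>\<tau>. \<tau> \<subseteq> \<sigma> \<longrightarrow> \<tau> \<in> K)"

definition vertices :: "'a set set \<Rightarrow> 'a set" where
  "vertices K = \<Union>K"

definition face_dim :: "'a set \<Rightarrow> int" where
  "face_dim \<sigma> = int (card \<sigma>) - 1"

definition maximal_face :: "'a set set \<Rightarrow> 'a set \<Rightarrow> bool" where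
  "maximal_face K \<sigma> \<longleftrightarrow> \<sigma> \<in> K \<and> (\<forall>\<rho>\<in>K. \<sigma> \<subseteq> \<rho> \<longrightarrow> \<rho> = \<sigma>)"

definition pure_complex :: "nat \<Rightarrow> 'a set set \<Rightarrow> bool" where
  "pure_complex k K \<longleftrightarrow>
     simplicial_complex K \<and> (\<forall>\<sigma>. maximal_face K \<sigma> \<longrightarrow> face_dim \<sigma> = int k)"

text \<open>Facets and ridges of a complex that is pure of dimension \<open>k\<close>.\<close>

definition facets :: "nat \<Rightarrow> 'a set set \<Rightarrow> 'a set set" where
  "facets k K = {\<sigma> \<in> K. face_dim \<sigma> = int k}"

definition ridges :: "nat \<Rightarrow> 'a set set \<Rightarrow> 'a set set" where
  "ridges k K = {\<tau> \<in> K. face_dim \<tau> = int k - 1}"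

definition in_exactly_one_facet :: "nat \<Rightarrow> 'a set set \<Rightarrow> 'a set \<Rightarrow> bool" where
  "in_exactly_one_facet k K \<tau> \<longleftrightarrow> (\<exists>!\<sigma>. \<sigma> \<in> facets k K \<and> \<tau> \<subseteq> \<sigma>)"

definition standard_ball :: "nat \<Rightarrow> 'a set set \<Rightarrow> bool" where
  "standard_ball k B \<longleftrightarrow> (\<exists>\<sigma>. finite \<sigma> \<and> face_dim \<sigma> = int k \<and> B = Pow \<sigma>)"

text \<open>All members of the sequence have the same dimension \<open>k\<close>.\<close>

definition stacked_ball :: "nat \<Rightarrow> 'a set set \<Rightarrow> bool" where
  "stacked_ball k B \<longleftrightarrow>
     (\<exists>m \<ge> 1. \<exists>Bs :: nat \<Rightarrow> 'a set set.
        (\<forall>i\<in>{1..m}. pure_complex k (Bs i)) \<and>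
        standard_ball k (Bs 1) \<and> Bs m = B \<and>
        (\<forall>i\<in>{2..m}. \<exists>\<sigma> \<tau>.
           \<sigma> \<in> facets k (Bs i) \<and> \<tau> \<in> ridges k (Bs i) \<and>
           in_exactly_one_facet k (Bs (i - 1)) \<tau> \<and>
           Bs i = Bs (i - 1) \<union> Pow \<sigma> \<and>
           Bs (i - 1) \<inter> Pow \<sigma> = Pow \<tau>))"

text \<open>The complex generated by the ridges lying in exactly one facet.\<close>

definition ball_boundary :: "nat \<Rightarrow> 'a set set \<Rightarrow> 'a set set" where
  "ball_boundary k B = (\<Union>\<tau>\<in>{\<tau> \<in> ridges k B. in_exactly_one_facet k B \<tau>}. Pow \<tau>)"

definition isomorphic_complexes :: "'a set set \<Rightarrow> 'b set set \<Rightarrow> bool" where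
  "isomorphic_complexes K L \<longleftrightarrow>
     (\<exists>f. bij_betw f (vertices K) (vertices L) \<and> L = (\<lambda>\<sigma>. f ` \<sigma>) ` K)"

text \<open>The ball may have vertices outside the sphere (this happens for 0-spheres). Taking its vertices
  to be natural numbers is no restriction, as every finite complex is isomorphic to one on
  natural numbers.\<close>

definition stacked_sphere :: "nat \<Rightarrow> 'a set set \<Rightarrow> bool" where
  "stacked_sphere k X \<longleftrightarrow>
     simplicial_complex X \<and>
     (\<exists>B :: nat set set. stacked_ball (k + 1) B \<and> isomorphic_complexes X (ball_boundary (k + 1) B))"

text \<open>The boundary complex of the simplex with vertex set \<open>V\<close>, i.e. the standard sphere of
  dimension \<open>card V - 2\<close> on \<open>V\<close>.\<close>

definition standard_sphere :: "'a set \<Rightarrow> 'a set set" where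
  "standard_sphere V = {\<sigma>. \<sigma> \<subset> V}"

end

theory Submission imports Defs begin

text \<open>The heart of the proof is that a stacked \<open>k\<close>-ball \<open>B\<close> with at least two facets lies in the
  boundary of a stacked \<open>(k+1)\<close>-ball \<open>B'\<close> with the same vertices. Build \<open>B'\<close> along with \<open>B\<close>, starting
  from the simplex spanned by the first two facets. When \<open>B\<close> grows by \<open>\<tau> \<union> {v}\<close>, where the ridge
  \<open>\<tau>\<close> lies in exactly one facet \<open>\<rho>\<close> of \<open>B\<close>, choose a second facet \<open>\<rho>' \<noteq> \<rho>\<close> of the boundary of
  \<open>B'\<close> through \<open>\<tau>\<close>, and let \<open>B'\<close> grow by \<open>\<rho>' \<union> {v}\<close>. The only face that the boundary of \<open>B'\<close> loses
  is \<open>\<rho>'\<close>, which is not a face of \<open>B\<close>, and \<open>\<tau> \<union> {v}\<close> becomes one of its faces. Iterating, the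
  boundaries increase up to the boundary of the simplex on all vertices. For 0-spheres the ball may
  have too many vertices, and is first replaced by an edge.\<close>

section \<open>Facet sets of stacked balls\<close>

definition generated :: "'a set set \<Rightarrow> 'a set set" where
  "generated F = (\<Union>\<sigma>\<in>F. Pow \<sigma>)"

text \<open>For the facet set \<open>F\<close> of a stacked \<open>k\<close>-ball these are the
  facets of its boundary; \<open>\<tau> \<subseteq> \<sigma>\<close> makes \<open>\<tau>\<close> a
  face of the ball.\<close>

definition free_ridges :: "nat \<Rightarrow> 'a set set \<Rightarrow> 'a set set" where
  "free_ridges k F = {\<tau>. card \<tau> = k \<and> (\<exists>!\<sigma>. \<sigma> \<in> F \<and> \<tau> \<subseteq> \<sigma>)}"

text \<open>\<open>F\<close> is the set of facets of a stacked \<open>k\<close>-ball.\<close>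

inductive stacked_facets :: "nat \<Rightarrow> 'a set set \<Rightarrow> bool" for k where
  simplex: "card \<sigma> = Suc k \<Longrightarrow> stacked_facets k {\<sigma>}"
| stack: "stacked_facets k F \<Longrightarrow> \<tau> \<in> free_ridges k F \<Longrightarrow> v \<notin> \<Union>F \<Longrightarrow>
    stacked_facets k (insert (insert v \<tau>) F)"

lemma in_generated: "\<rho> \<in> generated F \<longleftrightarrow> (\<exists>\<sigma>\<in>F. \<rho> \<subseteq> \<sigma>)"
  by (auto simp: generated_def)

lemma vertices_generated: "vertices (generated F) = \<Union>F"
  by (auto simp: vertices_def generated_def)

lemma generated_insert: "generated (insert \<sigma> F) = generated F \<union> Pow \<sigma>"
  by (auto simp: generated_def)

lemma generated_singleton [simp]: "generated {\<sigma>} = Pow \<sigma>"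
  by (auto simp: generated_def)

lemma free_ridge_subset:
  assumes "\<tau> \<in> free_ridges k F"
  obtains \<sigma> where "\<sigma> \<in> F" "\<tau> \<subseteq> \<sigma>"
  using assms by (auto simp: free_ridges_def)

lemma card_free_ridge: "\<tau> \<in> free_ridges k F \<Longrightarrow> card \<tau> = k"
  by (simp add: free_ridges_def)

lemma stacked_facets_card:
  assumes "stacked_facets k F"
  shows "finite F" "F \<noteq> {}" "\<And>\<sigma>. \<sigma> \<in> F \<Longrightarrow> card \<sigma> = Suc k"
proof -
  have "finite F \<and> F \<noteq> {} \<and> (\<forall>\<sigma>\<in>F. card \<sigma> = Suc k)"
    using assms
  proof induction
    case (stack F \<tau> v)
    obtain \<sigma> where \<sigma>: "\<sigma> \<in> F" "\<tau> \<subseteq> \<sigma>"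
      using stack.hyps(2) by (rule free_ridge_subset)
    then have "card \<sigma> = Suc k" using stack.IH by blast
    then have "finite \<tau>" using \<sigma> by (metis card.infinite finite_subset nat.distinct(1))
    moreover have "v \<notin> \<tau>" using \<sigma> stack.hyps(3) by auto
    ultimately show ?case using stack.IH card_free_ridge[OF stack.hyps(2)] by simp
  qed simp
  then show "finite F" "F \<noteq> {}" "\<And>\<sigma>. \<sigma> \<in> F \<Longrightarrow> card \<sigma> = Suc k" by auto
qed

lemma stacked_facets_finite:
  assumes "stacked_facets k F"
  shows "\<sigma> \<in> F \<Longrightarrow> finite \<sigma>" "finite (\<Union>F)" "\<tau> \<in> free_ridges k F \<Longrightarrow> finite \<tau>"
    "finite (free_ridges k F)"
proof -
  have fin: "finite \<sigma>" if "\<sigma> \<in> F" for \<sigma>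
    using stacked_facets_card(3)[OF assms that] by (metis card.infinite nat.distinct(1))
  then show "\<sigma> \<in> F \<Longrightarrow> finite \<sigma>" by simp
  show U: "finite (\<Union>F)" using fin stacked_facets_card(1)[OF assms] by blast
  have sub: "free_ridges k F \<subseteq> Pow (\<Union>F)" by (auto elim!: free_ridge_subset)
  with U show "finite (free_ridges k F)" by (meson finite_Pow_iff finite_subset)
  from sub U show "\<tau> \<in> free_ridges k F \<Longrightarrow> finite \<tau>" by (meson PowD finite_subset subsetD)
qed

lemma subset_card_Suc_eq:
  assumes "\<tau> \<subseteq> \<rho>" "card \<rho> = Suc (card \<tau>)"
  obtains x where "x \<in> \<rho>" "\<tau> = \<rho> - {x}" "x \<notin> \<tau>"
proof -
  have "finite \<rho>" using assms(2) by (metis card.infinite nat.distinct(1))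
  then have "card (\<rho> - \<tau>) = 1"
    using assms by (simp add: card_Diff_subset finite_subset)
  then obtain x where "\<rho> - \<tau> = {x}" by (auto simp: card_Suc_eq)
  then show ?thesis using that[of x] assms(1) by blast
qed

section \<open>The boundary under stacking\<close>

lemma free_ridges_singleton:
  "free_ridges k {\<sigma>} = {\<tau>. \<tau> \<subseteq> \<sigma> \<and> card \<tau> = k}"
  by (auto simp: free_ridges_def)

text \<open>A ridge through \<open>v\<close> can lie in the new facet only, so dropping any
  \<open>x\<close> in \<open>\<rho>\<close> from that facet gives a free ridge. A ridge avoiding
  \<open>v\<close> lies in the new facet only if it is \<open>\<rho>\<close>, which then lies in two
  facets; so \<open>\<rho>\<close> alone is lost.\<close>

lemma free_ridges_stack:
  assumes F: "stacked_facets k F" and \<rho>: "\<rho> \<in> free_ridges k F" and v: "v \<notin> \<Union>F"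
  shows "free_ridges k (insert (insert v \<rho>) F) =
    (free_ridges k F - {\<rho>}) \<union> {insert v (\<rho> - {x}) | x. x \<in> \<rho>}" (is "free_ridges k ?F = ?R")
proof -
  obtain \<sigma> where \<sigma>: "\<sigma> \<in> F" "\<rho> \<subseteq> \<sigma>" using \<rho> by (rule free_ridge_subset)
  then have v\<rho>: "v \<notin> \<rho>" using v by blast
  have fin: "finite \<rho>" using stacked_facets_finite(3)[OF F \<rho>] .
  have card\<rho>: "card \<rho> = k" using \<rho> by (rule card_free_ridge)
  have new: "insert v \<rho> \<notin> F" using v by blast
  have "\<tau> \<in> free_ridges k ?F \<longleftrightarrow> \<tau> \<in> ?R" for \<tau>
  proof (cases "v \<in> \<tau>")
    case True
    have "\<not> (\<exists>\<sigma>\<in>F. \<tau> \<subseteq> \<sigma>)" using True v by blast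
    then have "\<tau> \<in> free_ridges k ?F \<longleftrightarrow> card \<tau> = k \<and> \<tau> \<subseteq> insert v \<rho>"
      by (auto simp: free_ridges_def)
    also have "\<dots> \<longleftrightarrow> (\<exists>x\<in>\<rho>. \<tau> = insert v (\<rho> - {x}))"
    proof
      assume *: "card \<tau> = k \<and> \<tau> \<subseteq> insert v \<rho>"
      have "card (insert v \<rho>) = Suc (card \<tau>)" using * fin v\<rho> card\<rho> by simp
      then obtain x where x: "x \<in> insert v \<rho>" "\<tau> = insert v \<rho> - {x}" "x \<notin> \<tau>"
        using * by (metis subset_card_Suc_eq)
      then show "\<exists>x\<in>\<rho>. \<tau> = insert v (\<rho> - {x})" using True by (intro bexI[of _ x]) auto
    next
      assume "\<exists>x\<in>\<rho>. \<tau> = insert v (\<rho> - {x})"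
      then obtain x where "x \<in> \<rho>" "\<tau> = insert v (\<rho> - {x})" by blast
      then show "card \<tau> = k \<and> \<tau> \<subseteq> insert v \<rho>"
        using fin v\<rho> card\<rho> card_Suc_Diff1[of \<rho> x] by auto
    qed
    also have "\<dots> \<longleftrightarrow> \<tau> \<in> ?R" using True v by (auto elim!: free_ridge_subset)
    finally show ?thesis .
  next
    case False
    then have *: "\<tau> \<subseteq> insert v \<rho> \<longleftrightarrow> \<tau> \<subseteq> \<rho>" by blast
    have R: "\<tau> \<in> ?R \<longleftrightarrow> \<tau> \<in> free_ridges k F \<and> \<tau> \<noteq> \<rho>" using False by auto
    show ?thesis
    proof (cases "\<tau> = \<rho>")
      case True
      then show ?thesis unfolding R using \<sigma> new by (auto simp: free_ridges_def)
    next
      case False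
      then have "card \<tau> = k \<Longrightarrow> \<not> \<tau> \<subseteq> \<rho>"
        using fin card\<rho> by (metis card_subset_eq)
      then show ?thesis unfolding R using * False by (auto simp: free_ridges_def)
    qed
  qed
  then show ?thesis by blast
qed

text \<open>The boundary of a stacked ball has no boundary itself.\<close>

lemma second_free_ridge:
  assumes "stacked_facets k F" "\<rho> \<in> free_ridges k F" "\<tau> \<subseteq> \<rho>" "Suc (card \<tau>) = k"
  obtains \<rho>' where "\<rho>' \<in> free_ridges k F" "\<rho>' \<noteq> \<rho>" "\<tau> \<subseteq> \<rho>'"
proof -
  have "\<exists>\<rho>'\<in>free_ridges k F. \<rho>' \<noteq> \<rho> \<and> \<tau> \<subseteq> \<rho>'"
    using assms
  proof (induction arbitrary: \<rho> \<tau>)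
    case (simplex \<sigma>)
    then have \<rho>: "\<rho> \<subseteq> \<sigma>" "card \<rho> = k" by (auto simp: free_ridges_singleton)
    obtain x where x: "x \<in> \<rho>" "\<tau> = \<rho> - {x}"
      using simplex.prems \<rho> by (metis subset_card_Suc_eq)
    have "finite \<sigma>" using simplex.hyps by (metis card.infinite nat.distinct(1))
    then have "card (\<sigma> - {x}) = k" using simplex.hyps x \<rho> by (subst card_Diff_singleton) auto
    \<comment> \<open>The facet of the simplex boundary opposite \<open>x\<close> contains
      \<open>\<rho> - {x}\<close> and, lacking \<open>x\<close>, differs from
      \<open>\<rho>\<close>.\<close>
    then have "\<sigma> - {x} \<in> free_ridges k {\<sigma>}" by (auto simp: free_ridges_singleton)
    then show ?case using x \<rho> by (intro bexI[of _ "\<sigma> - {x}"]) auto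
  next
    case (stack F \<rho>0 v)
    note R = free_ridges_stack[OF stack.hyps]
    have v: "v \<notin> \<rho>0" using stack.hyps(2,3) by (auto elim!: free_ridge_subset)
    have card0: "card \<rho>0 = k" using stack.hyps(2) by (rule card_free_ridge)
    have fin0: "finite \<rho>0" using stacked_facets_finite(3)[OF stack.hyps(1,2)] .
    \<comment> \<open>The cases sort the free ridges through \<open>\<tau>\<close>: if
      \<open>v \<in> \<tau>\<close>, all of them are new; if
      \<open>\<tau> \<subseteq> \<rho>0\<close>, stacking loses \<open>\<rho>0\<close> and gains
      \<open>insert v \<tau>\<close>; otherwise they stay the same.\<close>
    consider "v \<in> \<tau>" | "v \<notin> \<tau>" "\<tau> \<subseteq> \<rho>0" | "v \<notin> \<tau>" "\<not> \<tau> \<subseteq> \<rho>0" by blast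
    then show ?case
    proof cases
      case 1
      then have "\<rho> \<notin> free_ridges k F"
        using stack.prems(2) stack.hyps(3) by (auto elim!: free_ridge_subset)
      then obtain x where x: "x \<in> \<rho>0" "\<rho> = insert v (\<rho>0 - {x})"
        using stack.prems(1) unfolding R by blast
      have "card \<rho> = Suc (card \<tau>)" using card_free_ridge[OF stack.prems(1)] stack.prems by simp
      then obtain y where y: "y \<in> \<rho>" "\<tau> = \<rho> - {y}" "y \<notin> \<tau>"
        using stack.prems(2) by (metis subset_card_Suc_eq)
      \<comment> \<open>From \<open>insert v \<rho>0\<close> the ridge \<open>\<rho>\<close> drops
        \<open>x\<close>, and \<open>\<tau>\<close> drops \<open>x\<close> and \<open>y\<close>; the
        second ridge drops \<open>y\<close> alone.\<close>
      then have yx: "y \<in> \<rho>0" "y \<noteq> x" "y \<noteq> v" using x 1 by auto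
      then have "insert v (\<rho>0 - {y}) \<in> free_ridges k (insert (insert v \<rho>0) F)"
        unfolding R by blast
      moreover have "insert v (\<rho>0 - {y}) \<noteq> \<rho>" using y(1) yx(3) by auto
      moreover have "\<tau> \<subseteq> insert v (\<rho>0 - {y})" unfolding y(2) x(2) by auto
      ultimately show ?thesis by (intro bexI conjI)
    next
      case 2
      then obtain x where x: "x \<in> \<rho>0" "\<tau> = \<rho>0 - {x}"
        using card0 stack.prems by (metis subset_card_Suc_eq)
      have new: "insert v \<tau> \<in> free_ridges k (insert (insert v \<rho>0) F)"
        unfolding R x(2) using x(1) by blast
      show ?thesis
      proof (cases "\<rho> = insert v \<tau>")
        case True
        \<comment> \<open>When \<open>\<rho>\<close> is the gained ridge, the partner that the lost
          ridge \<open>\<rho>0\<close> had at \<open>\<tau>\<close> becomes its partner.\<close>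
        obtain \<rho>' where "\<rho>' \<in> free_ridges k F" "\<rho>' \<noteq> \<rho>0" "\<tau> \<subseteq> \<rho>'"
          using stack.IH[OF stack.hyps(2) 2(2) stack.prems(3)] by blast
        moreover have "\<rho>' \<noteq> \<rho>"
          using True calculation(1) stack.hyps(3) by (auto elim!: free_ridge_subset)
        ultimately show ?thesis unfolding R by (intro bexI[of _ \<rho>'] conjI UnI1 DiffI) auto
      next
        case False
        then show ?thesis using new by (intro bexI[of _ "insert v \<tau>"]) auto
      qed
    next
      case 3
      have "\<rho> \<noteq> insert v (\<rho>0 - {x})" for x
        using 3 stack.prems(2) by auto
      then have "\<rho> \<in> free_ridges k F"
        using stack.prems(1) unfolding R by auto
      then obtain \<rho>' where "\<rho>' \<in> free_ridges k F" "\<rho>' \<noteq> \<rho>" "\<tau> \<subseteq> \<rho>'"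
        using stack.IH[of \<rho> \<tau>] stack.prems(2,3) by blast
      then show ?thesis unfolding R using 3 by (intro bexI[of _ \<rho>'] conjI UnI1 DiffI) auto
    qed
  qed
  then show ?thesis using that by blast
qed

section \<open>Vertices of the boundary\<close>

lemma Union_free_ridges_subset: "\<Union>(free_ridges k F) \<subseteq> \<Union>F"
  by (auto elim!: free_ridge_subset)

lemma Union_free_ridges_simplex:
  assumes "card \<sigma> = Suc k" "k \<ge> 1"
  shows "\<Union>(free_ridges k {\<sigma>}) = \<sigma>"
proof -
  have fin: "finite \<sigma>" using assms(1) by (metis card.infinite nat.distinct(1))
  have "x \<in> \<Union>(free_ridges k {\<sigma>})" if "x \<in> \<sigma>" for x
  proof -
    have "\<sigma> \<noteq> {x}" using assms by auto
    then obtain y where "y \<in> \<sigma>" "y \<noteq> x" using \<open>x \<in> \<sigma>\<close> by blast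
    then show ?thesis using that fin assms
      by (intro UnionI[of "\<sigma> - {y}"]) (auto simp: free_ridges_singleton)
  qed
  then show ?thesis by (auto simp: free_ridges_singleton)
qed

text \<open>Stacking removes only \<open>\<rho>\<close> from the boundary, and as
  \<open>\<rho>\<close> has at least two vertices, each of them survives in some
  \<open>insert v (\<rho> - {y})\<close>. For \<open>k = 1\<close> this breaks down: a path has only
  its two ends on the boundary.\<close>

lemma Union_free_ridges:
  assumes "stacked_facets k F" "k \<ge> 2"
  shows "\<Union>(free_ridges k F) = \<Union>F"
  using assms(1)
proof induction
  case (simplex \<sigma>)
  then show ?case using assms(2) by (simp add: Union_free_ridges_simplex)
next
  case (stack F \<rho> v)
  note R = free_ridges_stack[OF stack.hyps]
  have card\<rho>: "card \<rho> = k" using stack.hyps(2) by (rule card_free_ridge)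
  then have ne: "\<rho> \<noteq> {}" using assms(2) by auto
  have "x \<in> \<Union>(free_ridges k (insert (insert v \<rho>) F))" if x: "x \<in> \<Union>(insert (insert v \<rho>) F)" for x
  proof -
    consider "x = v" | "x \<in> \<rho>" | "x \<in> \<Union>F" "x \<notin> \<rho>" using x by blast
    then show ?thesis
    proof cases
      case 1
      then show ?thesis unfolding R using ne by blast
    next
      case 2
      have "\<rho> \<noteq> {x}" using card\<rho> assms(2) by auto
      then obtain y where "y \<in> \<rho>" "y \<noteq> x" using 2 by blast
      then show ?thesis unfolding R using 2 by blast
    next
      case 3
      then obtain \<tau> where "\<tau> \<in> free_ridges k F" "x \<in> \<tau>" using stack.IH by blast
      then show ?thesis unfolding R using 3 by blast
    qed
  qed
  then show ?case by (intro equalityI Union_free_ridges_subset subsetI)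
qed

text \<open>A stacked 1-ball is a path, and stacking an edge replaces one of its ends by
  \<open>v\<close>.\<close>

lemma free_ridges_dim_one:
  assumes "stacked_facets 1 F"
  obtains a b where "a \<noteq> b" "free_ridges 1 F = {{a}, {b}}"
proof -
  have "\<exists>a b. a \<noteq> b \<and> free_ridges 1 F = {{a}, {b}}"
    using assms
  proof induction
    case (simplex \<sigma>)
    then obtain a b where "\<sigma> = {a, b}" "a \<noteq> b" by (auto simp: card_Suc_eq)
    then have "free_ridges 1 {\<sigma>} = {{a}, {b}}"
      by (auto simp: free_ridges_singleton card_1_singleton_iff)
    then show ?case using \<open>a \<noteq> b\<close> by blast
  next
    case (stack F \<rho> v)
    note R = free_ridges_stack[OF stack.hyps]
    obtain a b where ab: "a \<noteq> b" "free_ridges 1 F = {{a}, {b}}" using stack.IH by blast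
    have v: "v \<noteq> a" "v \<noteq> b" using ab(2) Union_free_ridges_subset[of 1 F] stack.hyps(3) by auto
    have "\<rho> = {a} \<or> \<rho> = {b}" using ab stack.hyps(2) by blast
    then have "free_ridges 1 (insert (insert v \<rho>) F) = {{v}, {b}} \<or>
      free_ridges 1 (insert (insert v \<rho>) F) = {{v}, {a}}"
      unfolding R ab(2) using ab(1) by auto
    then show ?case using v by blast
  qed
  then show ?thesis using that by blast
qed

section \<open>Raising the dimension on a fixed vertex set\<close>

text \<open>A single simplex is excepted, since a larger one would need another vertex. The
  inclusion is stated for facets, so that each facet of \<open>F\<close> is a free ridge of
  \<open>F'\<close> and \<open>second_free_ridge\<close> applies to it at the next stacking.\<close>

lemma stacked_facets_raise_dim:
  assumes "stacked_facets k F" "k \<ge> 1"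
  shows "(\<exists>\<sigma>. F = {\<sigma>}) \<or>
    (\<exists>F'. stacked_facets (Suc k) F' \<and> \<Union>F' = \<Union>F \<and> F \<subseteq> free_ridges (Suc k) F')"
  using assms(1)
proof induction
  case (stack F \<tau> v)
  obtain \<rho> where \<rho>: "\<rho> \<in> F" "\<tau> \<subseteq> \<rho>" and unique: "\<And>\<sigma>. \<sigma> \<in> F \<Longrightarrow> \<tau> \<subseteq> \<sigma> \<Longrightarrow> \<sigma> = \<rho>"
    using stack.hyps(2) by (auto simp: free_ridges_def)
  have cards: "card \<tau> = k" "card \<rho> = Suc k"
    using card_free_ridge[OF stack.hyps(2)] stacked_facets_card(3)[OF stack.hyps(1) \<rho>(1)] by auto
  have fin: "finite \<rho>" "finite \<tau>"
    using stacked_facets_finite[OF stack.hyps(1)] \<rho> stack.hyps(2) by auto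
  have v: "v \<notin> \<rho>" "v \<notin> \<tau>" using \<rho> stack.hyps(3) by auto
  from stack.IH show ?case
  proof
    assume "\<exists>\<sigma>. F = {\<sigma>}"
    then have F: "F = {\<rho>}" using \<rho> by blast
    \<comment> \<open>The first two facets, \<open>\<rho>\<close> and
      \<open>insert v \<tau>\<close>, are both ridges of the simplex \<open>insert v \<rho>\<close>,
      and together they cover it.\<close>
    have "stacked_facets (Suc k) {insert v \<rho>}"
      using fin v cards by (intro stacked_facets.simplex) simp
    moreover have "insert (insert v \<tau>) F \<subseteq> free_ridges (Suc k) {insert v \<rho>}"
      using F \<rho> v fin cards by (auto simp: free_ridges_singleton)
    moreover have "\<Union>{insert v \<rho>} = \<Union>(insert (insert v \<tau>) F)" using F \<rho> by auto
    ultimately show ?thesis by blast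
  next
    assume "\<exists>F'. stacked_facets (Suc k) F' \<and> \<Union>F' = \<Union>F \<and> F \<subseteq> free_ridges (Suc k) F'"
    then obtain F' where F': "stacked_facets (Suc k) F'" "\<Union>F' = \<Union>F" "F \<subseteq> free_ridges (Suc k) F'"
      by blast
    \<comment> \<open>Since \<open>\<rho>\<close> is a facet of the boundary of \<open>F'\<close>
      and \<open>\<tau>\<close> has one vertex less, a second boundary facet passes through
      \<open>\<tau>\<close>.\<close>
    obtain \<rho>' where \<rho>': "\<rho>' \<in> free_ridges (Suc k) F'" "\<rho>' \<noteq> \<rho>" "\<tau> \<subseteq> \<rho>'"
      using second_free_ridge[of "Suc k" F' \<rho> \<tau>] F' \<rho> cards by blast
    have v': "v \<notin> \<Union>F'" using F'(2) stack.hyps(3) by simp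
    note R = free_ridges_stack[OF F'(1) \<rho>'(1) v']
    \<comment> \<open>Only \<open>\<rho>\<close> passes through \<open>\<tau>\<close> within
      \<open>F\<close>, so giving up \<open>\<rho>'\<close> costs no facet of
      \<open>F\<close>.\<close>
    have "\<rho>' \<notin> F" using unique \<rho>' by blast
    then have "F \<subseteq> free_ridges (Suc k) (insert (insert v \<rho>') F')"
      unfolding R using F'(3) by blast
    \<comment> \<open>Thus \<open>insert v \<tau>\<close> is
      \<open>insert v (\<rho>' - {x})\<close>, one of the ridges gained by stacking on
      \<open>\<rho>'\<close>.\<close>
    moreover obtain x where "x \<in> \<rho>'" "\<tau> = \<rho>' - {x}"
      using \<rho>'(3) card_free_ridge[OF \<rho>'(1)] cards by (metis subset_card_Suc_eq)
    then have "insert v \<tau> \<in> free_ridges (Suc k) (insert (insert v \<rho>') F')"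
      unfolding R by blast
    ultimately have "insert (insert v \<tau>) F \<subseteq> free_ridges (Suc k) (insert (insert v \<rho>') F')"
      by blast
    moreover have "\<rho>' \<subseteq> \<Union>F" using \<rho>'(1) Union_free_ridges_subset[of "Suc k" F'] unfolding F'(2) by blast
    then have "\<Union>(insert (insert v \<rho>') F') = \<Union>(insert (insert v \<tau>) F)"
      using F'(2) \<rho> by auto
    ultimately show ?thesis using stacked_facets.stack[OF F'(1) \<rho>'(1) v'] by blast
  qed
qed blast

text \<open>Raising the dimension can be repeated until a single simplex is left, which then has all
  \<open>N + 1\<close> vertices. \<open>G j\<close> holds the facets of a \<open>j\<close>-ball, so
  its boundary has dimension \<open>j - 1\<close>. The third assumption excludes the longer paths
  for \<open>k = 1\<close>, whose inner vertices are missing from the boundary.\<close>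

lemma stacked_facets_chain:
  assumes "stacked_facets k F" "k \<ge> 1" "\<Union>(free_ridges k F) = \<Union>F" "card (\<Union>F) = Suc N"
  shows "k \<le> N \<and> (\<exists>G. G k = F \<and> G N = {\<Union>F} \<and>
    (\<forall>j\<in>{k..N}. stacked_facets j (G j) \<and> \<Union>(free_ridges j (G j)) = \<Union>F) \<and>
    (\<forall>j\<in>{k..<N}. generated (free_ridges j (G j)) \<subseteq> generated (free_ridges (Suc j) (G (Suc j)))))"
  using assms
proof (induction "N - k" arbitrary: k F rule: less_induct)
  case (less k F)
  from stacked_facets_raise_dim[OF less.prems(1,2)] show ?case
  proof
    assume "\<exists>\<sigma>. F = {\<sigma>}"
    then obtain \<sigma> where F: "F = {\<sigma>}" by blast
    then have "k = N" using stacked_facets_card(3)[OF less.prems(1), of \<sigma>] less.prems(4) by simp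
    then show ?thesis using F less.prems(1,3) by (intro conjI exI[of _ "\<lambda>_. F"]) simp_all
  next
    assume "\<exists>F'. stacked_facets (Suc k) F' \<and> \<Union>F' = \<Union>F \<and> F \<subseteq> free_ridges (Suc k) F'"
    then obtain F' where F': "stacked_facets (Suc k) F'" "\<Union>F' = \<Union>F" "F \<subseteq> free_ridges (Suc k) F'"
      by blast
    \<comment> \<open>As \<open>Suc k\<close> is at least 2, the third assumption is inherited by
      \<open>F'\<close>.\<close>
    have U: "\<Union>(free_ridges (Suc k) F') = \<Union>F'"
      using Union_free_ridges[OF F'(1)] less.prems(2) by simp
    obtain \<sigma> where \<sigma>: "\<sigma> \<in> F'" using stacked_facets_card(2)[OF F'(1)] by blast
    \<comment> \<open>A facet of \<open>F'\<close> uses \<open>k + 2\<close> of the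
      \<open>N + 1\<close> vertices; hence \<open>k < N\<close>, and the induction measure
      drops.\<close>
    have "card \<sigma> \<le> card (\<Union>F')"
      using \<sigma> stacked_facets_finite(2)[OF F'(1)] by (intro card_mono) auto
    then have "k < N"
      using stacked_facets_card(3)[OF F'(1) \<sigma>] F'(2) less.prems(4) by simp
    then have "N - Suc k < N - k" "1 \<le> Suc k" by simp_all
    moreover have "card (\<Union>F') = Suc N" using F'(2) less.prems(4) by simp
    ultimately obtain G where G: "G (Suc k) = F'" "G N = {\<Union>F'}"
      "\<forall>j\<in>{Suc k..N}. stacked_facets j (G j) \<and> \<Union>(free_ridges j (G j)) = \<Union>F'"
      "\<forall>j\<in>{Suc k..<N}. generated (free_ridges j (G j)) \<subseteq> generated (free_ridges (Suc j) (G (Suc j)))"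
      using less.hyps[OF _ F'(1) _ U] by blast
    \<comment> \<open>The boundary of the ball lies in the ball, and the ball lies in the boundary
      of the next one.\<close>
    have "generated (free_ridges k F) \<subseteq> generated F"
      unfolding generated_def free_ridges_def by blast
    also have "\<dots> \<subseteq> generated (free_ridges (Suc k) F')"
      using F'(3) unfolding generated_def by (rule Union_mono[OF image_mono])
    finally have inc: "generated (free_ridges k F) \<subseteq> generated (free_ridges (Suc k) F')" .
    have "\<forall>j\<in>{k..N}. stacked_facets j ((G(k := F)) j) \<and> \<Union>(free_ridges j ((G(k := F)) j)) = \<Union>F"
      using G(3) F'(2) less.prems by auto
    moreover have "\<forall>j\<in>{k..<N}. generated (free_ridges j ((G(k := F)) j)) \<subseteq>
        generated (free_ridges (Suc j) ((G(k := F)) (Suc j)))"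
    proof
      fix j assume "j \<in> {k..<N}"
      then consider "j = k" | "j \<noteq> k" "j \<in> {Suc k..<N}" by fastforce
      then show "generated (free_ridges j ((G(k := F)) j)) \<subseteq>
        generated (free_ridges (Suc j) ((G(k := F)) (Suc j)))"
        using G(1,4) inc by cases auto
    qed
    ultimately show ?thesis using \<open>k < N\<close> G(2) F'(2)
      by (intro conjI exI[of _ "G(k := F)"]) auto
  qed
qed

section \<open>From facet sets to complexes and back\<close>

lemma simplicial_complex_generated:
  assumes "finite F" "F \<noteq> {}" "\<And>\<sigma>. \<sigma> \<in> F \<Longrightarrow> finite \<sigma>"
  shows "simplicial_complex (generated F)"
  using assms unfolding simplicial_complex_def generated_def
  by (auto intro: finite_subset)

text \<open>A face with as many vertices as the facet containing it equals that facet.\<close>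

lemma facets_generated:
  assumes "stacked_facets k F"
  shows "facets k (generated F) = F"
proof -
  have "\<rho> \<in> F" if "\<rho> \<subseteq> \<sigma>" "\<sigma> \<in> F" "card \<rho> = Suc k" for \<rho> \<sigma>
    using that stacked_facets_card(3)[OF assms] stacked_facets_finite(1)[OF assms]
    by (metis card_subset_eq)
  then show ?thesis
    using stacked_facets_card(3)[OF assms]
    by (fastforce simp: facets_def face_dim_def in_generated)
qed

lemma in_exactly_one_facet_generated:
  assumes "stacked_facets k F"
  shows "in_exactly_one_facet k (generated F) \<tau> \<longleftrightarrow> (\<exists>!\<sigma>. \<sigma> \<in> F \<and> \<tau> \<subseteq> \<sigma>)"
  by (simp add: in_exactly_one_facet_def facets_generated[OF assms])

lemma ball_boundary_generated:
  assumes "stacked_facets k F"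
  shows "ball_boundary k (generated F) = generated (free_ridges k F)"
proof -
  have "{\<tau> \<in> ridges k (generated F). in_exactly_one_facet k (generated F) \<tau>} = free_ridges k F"
    unfolding in_exactly_one_facet_generated[OF assms]
    by (auto simp: ridges_def face_dim_def in_generated free_ridges_def)
  then show ?thesis by (simp add: ball_boundary_def generated_def)
qed

lemma pure_complex_generated:
  assumes "stacked_facets k F"
  shows "pure_complex k (generated F)"
proof -
  have "simplicial_complex (generated F)"
    using stacked_facets_card[OF assms] stacked_facets_finite[OF assms]
    by (intro simplicial_complex_generated) auto
  moreover have "face_dim \<sigma> = int k" if max: "maximal_face (generated F) \<sigma>" for \<sigma>
  proof -
    obtain \<rho> where \<rho>: "\<rho> \<in> F" "\<sigma> \<subseteq> \<rho>" using max by (auto simp: maximal_face_def in_generated)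
    moreover have "\<rho> \<in> generated F" using \<rho> by (auto simp: in_generated)
    ultimately have "\<rho> = \<sigma>" using max by (auto simp: maximal_face_def)
    then show ?thesis using stacked_facets_card(3)[OF assms] \<rho> by (simp add: face_dim_def)
  qed
  ultimately show ?thesis by (auto simp: pure_complex_def)
qed

abbreviation stacking_step :: "nat \<Rightarrow> 'a set set \<Rightarrow> 'a set set \<Rightarrow> bool" where
  "stacking_step k A B \<equiv> (\<exists>\<sigma> \<tau>. \<sigma> \<in> facets k B \<and> \<tau> \<in> ridges k B \<and>
     in_exactly_one_facet k A \<tau> \<and> B = A \<union> Pow \<sigma> \<and> A \<inter> Pow \<sigma> = Pow \<tau>)"

text \<open>Each step of the sequence adds one facet \<open>\<sigma>\<close>, which has one vertex
  more than \<open>\<tau>\<close>; the intersection condition says that this vertex is new.\<close>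

lemma stacked_ball_imp_stacked_facets:
  fixes B :: "'a set set"
  assumes "stacked_ball k B"
  obtains F where "stacked_facets k F" "B = generated F"
proof -
  obtain m and Bs :: "nat \<Rightarrow> 'a set set" where m: "m \<ge> 1" and first: "standard_ball k (Bs 1)" and last: "Bs m = B"
    and steps: "\<forall>i\<in>{2..m}. stacking_step k (Bs (i - 1)) (Bs i)"
    using assms unfolding stacked_ball_def by (elim exE conjE) (rule that)
  have "i \<le> m \<longrightarrow> (\<exists>F. stacked_facets k F \<and> Bs i = generated F)" if "i \<ge> 1" for i
    using that
  proof (induction i rule: dec_induct)
    case base
    obtain \<sigma> where "face_dim \<sigma> = int k" "Bs 1 = Pow \<sigma>"
      using first by (auto simp: standard_ball_def)
    then have "stacked_facets k {\<sigma>}" "Bs 1 = generated {\<sigma>}"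
      by (auto simp: face_dim_def intro!: stacked_facets.simplex)
    then show ?case by blast
  next
    case (step i)
    show ?case
    proof
      assume "Suc i \<le> m"
      then obtain F where F: "stacked_facets k F" "Bs i = generated F" using step.IH by auto
      have "Suc i \<in> {2..m}" using \<open>Suc i \<le> m\<close> step.hyps by auto
      with steps obtain \<sigma> \<tau> where \<sigma>: "\<sigma> \<in> facets k (Bs (Suc i))"
        and \<tau>: "\<tau> \<in> ridges k (Bs (Suc i))" "in_exactly_one_facet k (generated F) \<tau>"
        and B: "Bs (Suc i) = generated F \<union> Pow \<sigma>" "generated F \<inter> Pow \<sigma> = Pow \<tau>"
        unfolding F(2)[symmetric] by (metis diff_Suc_1)
      have cards: "card \<sigma> = Suc k" "card \<tau> = k"
        using \<sigma> \<tau> by (auto simp: facets_def ridges_def face_dim_def)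
      have "\<tau> \<in> free_ridges k F"
        using \<tau>(2) cards by (simp add: in_exactly_one_facet_generated[OF F(1)] free_ridges_def)
      moreover have "\<tau> \<subseteq> \<sigma>" using B(2) by blast
      then obtain v where v: "v \<in> \<sigma>" "\<tau> = \<sigma> - {v}" "v \<notin> \<tau>"
        using cards by (metis subset_card_Suc_eq)
      \<comment> \<open>An old vertex \<open>v\<close> would put the face \<open>{v}\<close> into
        the intersection \<open>Pow \<tau>\<close>, although
        \<open>v \<notin> \<tau>\<close>.\<close>
      have "v \<notin> \<Union>F"
      proof
        assume "v \<in> \<Union>F"
        then have "{v} \<in> generated F \<inter> Pow \<sigma>" using v by (auto simp: in_generated)
        then show False using v unfolding B(2) by blast
      qed
      moreover have "insert v \<tau> = \<sigma>" using v by blast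
      ultimately have "stacked_facets k (insert \<sigma> F)" using F(1) stacked_facets.stack by metis
      then show "\<exists>F. stacked_facets k F \<and> Bs (Suc i) = generated F"
        using B(1) generated_insert by metis
    qed
  qed
  from this[OF m] show ?thesis using last that by auto
qed

text \<open>The sequence for \<open>F\<close> is prolonged by one complex. As \<open>v\<close> is
  new, an old face inside \<open>insert v \<tau>\<close> avoids \<open>v\<close>, so the
  intersection is \<open>Pow \<tau>\<close>.\<close>

lemma stacked_facets_imp_stacked_ball:
  fixes F :: "'a set set"
  assumes "stacked_facets k F"
  shows "stacked_ball k (generated F)"
  using assms
proof induction
  case (simplex \<sigma>)
  then have "finite \<sigma>" by (metis card.infinite nat.distinct(1))
  then have "standard_ball k (Pow \<sigma>)" using simplex by (auto simp: standard_ball_def face_dim_def)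
  then show ?case
    using pure_complex_generated[OF stacked_facets.simplex[OF simplex]]
    unfolding stacked_ball_def
    by (intro exI[of _ "1::nat"] conjI exI[of _ "\<lambda>_. Pow \<sigma>"]) auto
next
  case (stack F \<tau> v)
  let ?F = "insert (insert v \<tau>) F"
  have F': "stacked_facets k ?F" using stack.hyps by (rule stacked_facets.stack)
  obtain m and Bs :: "nat \<Rightarrow> 'a set set" where m: "m \<ge> 1" and pure: "\<forall>i\<in>{1..m}. pure_complex k (Bs i)"
    and first: "standard_ball k (Bs 1)" and last: "Bs m = generated F"
    and steps: "\<forall>i\<in>{2..m}. stacking_step k (Bs (i - 1)) (Bs i)"
    using stack.IH unfolding stacked_ball_def by (elim exE conjE) (rule that)
  define Bs' where "Bs' = Bs(Suc m := generated ?F)"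
  have "\<forall>i\<in>{1..Suc m}. pure_complex k (Bs' i)"
    using pure pure_complex_generated[OF F'] by (auto simp: Bs'_def)
  moreover have "standard_ball k (Bs' 1)" using first m by (auto simp: Bs'_def)
  moreover have "stacking_step k (Bs' (i - 1)) (Bs' i)" if "i \<in> {2..Suc m}" for i
  proof (cases "i = Suc m")
    case False
    then have "i \<in> {2..m}" "Bs' i = Bs i" "Bs' (i - 1) = Bs (i - 1)"
      using that by (auto simp: Bs'_def)
    then show ?thesis using steps by metis
  next
    case True
    then have eqs: "Bs' i = generated ?F" "Bs' (i - 1) = generated F"
      using last by (auto simp: Bs'_def)
    obtain \<rho> where \<rho>: "\<rho> \<in> F" "\<tau> \<subseteq> \<rho>" using stack.hyps(2) by (rule free_ridge_subset)
    have "insert v \<tau> \<in> facets k (generated ?F)" by (simp add: facets_generated[OF F'])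
    moreover have "\<tau> \<in> ridges k (generated ?F)"
      using card_free_ridge[OF stack.hyps(2)] by (auto simp: ridges_def face_dim_def in_generated)
    moreover have "in_exactly_one_facet k (generated F) \<tau>"
      using stack.hyps(2)
      by (simp add: in_exactly_one_facet_generated[OF stack.hyps(1)] free_ridges_def)
    moreover have "generated ?F = generated F \<union> Pow (insert v \<tau>)" by (rule generated_insert)
    moreover have "generated F \<inter> Pow (insert v \<tau>) = Pow \<tau>"
    proof
      show "Pow \<tau> \<subseteq> generated F \<inter> Pow (insert v \<tau>)"
        using \<rho> unfolding generated_def by blast
      show "generated F \<inter> Pow (insert v \<tau>) \<subseteq> Pow \<tau>"
        using stack.hyps(3) unfolding generated_def by blast
    qed
    ultimately show ?thesis unfolding eqs by blast
  qed
  ultimately show ?case unfolding stacked_ball_def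
    by (intro exI[of _ "Suc m"] conjI exI[of _ Bs']) (auto simp: Bs'_def)
qed

text \<open>A proper subset of \<open>V\<close> misses some vertex \<open>x\<close> and so lies in
  the ridge \<open>V - {x}\<close>.\<close>

lemma generated_free_ridges_simplex:
  assumes "card V = Suc k"
  shows "generated (free_ridges k {V}) = standard_sphere V"
proof -
  have fin: "finite V" using assms by (metis card.infinite nat.distinct(1))
  have "\<exists>\<tau>\<subseteq>V. card \<tau> = k \<and> \<rho> \<subseteq> \<tau>" if \<rho>: "\<rho> \<subset> V" for \<rho>
  proof -
    obtain x where "x \<in> V" "x \<notin> \<rho>" using \<rho> by blast
    then show ?thesis using \<rho> assms fin by (intro exI[of _ "V - {x}"]) auto
  qed
  moreover have "\<rho> \<subset> V" if "\<rho> \<subseteq> \<tau>" "\<tau> \<subseteq> V" "card \<tau> = k" for \<rho> \<tau>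
    using that assms by auto
  ultimately show ?thesis
    by (fastforce simp: standard_sphere_def in_generated free_ridges_singleton)
qed

text \<open>For \<open>k \<ge> 2\<close> the facets of \<open>B\<close> itself serve. For
  \<open>k = 1\<close> the path is replaced by the edge joining its ends, which has the same
  boundary but no inner vertices.\<close>

lemma stacked_ball_boundary_cases:
  assumes "stacked_ball k B" "k \<ge> 1"
  obtains F where "stacked_facets k F" "ball_boundary k B = generated (free_ridges k F)"
    "\<Union>(free_ridges k F) = \<Union>F"
proof -
  obtain F where F: "stacked_facets k F" "B = generated F"
    using assms(1) by (rule stacked_ball_imp_stacked_facets)
  have B: "ball_boundary k B = generated (free_ridges k F)"
    using ball_boundary_generated[OF F(1)] F(2) by simp
  show ?thesis
  proof (cases "k = 1")
    case False
    then show ?thesis using that[OF F(1) B] Union_free_ridges[OF F(1)] assms(2) by simp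
  next
    case True
    then obtain a b where ab: "a \<noteq> b" "free_ridges 1 F = {{a}, {b}}"
      using F(1) free_ridges_dim_one by blast
    have c: "card {a, b} = Suc k" using True ab by simp
    have "free_ridges k {{a, b}} = free_ridges k F"
      using ab True by (auto simp: free_ridges_singleton card_1_singleton_iff)
    then show ?thesis
      using that[of "{{a, b}}"] stacked_facets.simplex[OF c] B Union_free_ridges_simplex[OF c]
        assms(2) by simp
  qed
qed

section \<open>Transport along injective vertex maps\<close>

lemma simplicial_complex_image:
  assumes "simplicial_complex K"
  shows "simplicial_complex ((`) g ` K)"
  unfolding simplicial_complex_def
proof (intro conjI ballI allI impI)
  fix \<sigma> \<tau> assume "\<sigma> \<in> (`) g ` K" "\<tau> \<subseteq> \<sigma>"
  then obtain \<rho> where \<rho>: "\<rho> \<in> K" "\<tau> \<subseteq> g ` \<rho>" by blast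
  then obtain \<rho>' where "\<rho>' \<subseteq> \<rho>" "\<tau> = g ` \<rho>'" by (meson subset_imageE)
  then show "\<tau> \<in> (`) g ` K" using assms \<rho> by (auto simp: simplicial_complex_def)
qed (use assms in \<open>auto simp: simplicial_complex_def\<close>)

lemma vertices_image: "vertices ((`) g ` K) = g ` vertices K"
  by (auto simp: vertices_def)

lemma image_complex_inverse:
  assumes "\<And>x. x \<in> vertices K \<Longrightarrow> f (g x) = x"
  shows "(`) f ` (`) g ` K = K"
proof -
  have "f ` g ` \<sigma> = \<sigma>" if "\<sigma> \<in> K" for \<sigma>
  proof -
    have "f (g x) = x" if "x \<in> \<sigma>" for x
      using that \<open>\<sigma> \<in> K\<close> assms by (auto simp: vertices_def)
    then show ?thesis by (simp add: image_comp)
  qed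
  then show ?thesis by (simp add: image_comp)
qed

text \<open>The ball required by \<open>stacked_sphere\<close> lives on natural numbers, as
  \<open>F\<close> does, while the sphere may live on any type; the inverse of \<open>g\<close> is
  the isomorphism from the sphere to the boundary of the ball.\<close>

lemma stacked_sphere_image:
  fixes F :: "nat set set"
  assumes F: "stacked_facets (Suc j) F"
    and g: "inj_on g (\<Union>(free_ridges (Suc j) F))"
  shows "stacked_sphere j ((`) g ` generated (free_ridges (Suc j) F))"
proof -
  let ?K = "generated (free_ridges (Suc j) F)"
  let ?V = "\<Union>(free_ridges (Suc j) F)"
  have V: "vertices ?K = ?V" by (rule vertices_generated)
  \<comment> \<open>With no free ridge the generated family would be empty and lack the empty
    face.\<close>
  have "free_ridges (Suc j) F \<noteq> {}"
  proof (cases "j = 0")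
    case True
    then show ?thesis using F free_ridges_dim_one[of F] by (metis One_nat_def insert_not_empty)
  next
    case False
    then have "?V = \<Union>F" using Union_free_ridges[OF F] by simp
    moreover obtain \<sigma> where "\<sigma> \<in> F" using stacked_facets_card(2)[OF F] by blast
    moreover have "\<sigma> \<noteq> {}" using stacked_facets_card(3)[OF F \<open>\<sigma> \<in> F\<close>] by auto
    ultimately show ?thesis by blast
  qed
  then have "simplicial_complex ?K"
    using stacked_facets_finite[OF F] by (intro simplicial_complex_generated) auto
  then have "simplicial_complex ((`) g ` ?K)" by (rule simplicial_complex_image)
  moreover have "isomorphic_complexes ((`) g ` ?K) ?K"
    unfolding isomorphic_complexes_def
  proof (intro exI conjI)
    show "bij_betw (inv_into ?V g) (vertices ((`) g ` ?K)) (vertices ?K)"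
      unfolding vertices_image V using g by (intro bij_betw_inv_into) (simp add: inj_on_imp_bij_betw)
    show "?K = (`) (inv_into ?V g) ` (`) g ` ?K"
      using g by (subst image_complex_inverse) (auto simp: V)
  qed
  ultimately show ?thesis
    using stacked_facets_imp_stacked_ball[OF F] ball_boundary_generated[OF F]
    unfolding stacked_sphere_def by auto
qed

lemma standard_sphere_image:
  assumes "inj_on g V"
  shows "(`) g ` standard_sphere V = standard_sphere (g ` V)"
proof
  show "(`) g ` standard_sphere V \<subseteq> standard_sphere (g ` V)"
    using assms by (auto simp: standard_sphere_def inj_on_image_eq_iff psubset_eq)
  show "standard_sphere (g ` V) \<subseteq> (`) g ` standard_sphere V"
  proof
    fix \<sigma> assume "\<sigma> \<in> standard_sphere (g ` V)"
    then have \<sigma>: "\<sigma> \<subseteq> g ` V" "\<sigma> \<noteq> g ` V" by (auto simp: standard_sphere_def)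
    then obtain \<tau> where "\<tau> \<subseteq> V" "\<sigma> = g ` \<tau>" by (meson subset_imageE)
    then show "\<sigma> \<in> (`) g ` standard_sphere V" using \<sigma> by (auto simp: standard_sphere_def)
  qed
qed

section \<open>The chain on the vertices of \<open>X\<close>\<close>

theorem corollary6:
  fixes d n :: nat and X :: "'a set set"
  assumes "d \<ge> 1"
    and "stacked_sphere (d - 1) X"
    and "card (vertices X) = n"
  shows "d - 1 \<le> n - 2 \<and> n \<ge> 2 \<and>
    (\<exists>Y :: nat \<Rightarrow> 'a set set.
       Y (d - 1) = X \<and>
       Y (n - 2) = standard_sphere (vertices X) \<and>
       (\<forall>j\<in>{d - 1..n - 2}. stacked_sphere j (Y j) \<and> card (vertices (Y j)) = n) \<and>
       (\<forall>j\<in>{d - 1..<n - 2}. Y j \<subseteq> Y (j + 1)))"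
proof -
  obtain B :: "nat set set" and f where B: "stacked_ball d B"
    and f: "bij_betw f (vertices X) (vertices (ball_boundary d B))" "ball_boundary d B = (`) f ` X"
    using assms(1,2) by (auto simp: stacked_sphere_def isomorphic_complexes_def)
  \<comment> \<open>\<open>F\<close> shares its boundary with \<open>B\<close> but, for
    \<open>d = 1\<close>, may belong to a smaller ball, so that \<open>\<Union>F\<close> is exactly
    the vertex set of the sphere.\<close>
  obtain F where F: "stacked_facets d F" "ball_boundary d B = generated (free_ridges d F)"
    "\<Union>(free_ridges d F) = \<Union>F"
    using B assms(1) by (rule stacked_ball_boundary_cases)
  define W where "W = \<Union>F"
  have bd: "vertices (ball_boundary d B) = W" using F by (simp add: vertices_generated W_def)
  have cardW: "card W = n" using f(1) assms(3) bd by (metis bij_betw_same_card)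
  have finW: "finite W" unfolding W_def using F(1) by (rule stacked_facets_finite)
  obtain \<sigma> where \<sigma>: "\<sigma> \<in> F" using stacked_facets_card(2)[OF F(1)] by blast
  then have "card \<sigma> \<le> n" using finW cardW by (metis Sup_upper W_def card_mono)
  \<comment> \<open>One facet has \<open>d + 1\<close> vertices. So \<open>n \<ge> 2\<close>, and
    the subtractions \<open>n - 1\<close> and \<open>n - 2\<close> are not truncated.\<close>
  then have n: "Suc d \<le> n" using stacked_facets_card(3)[OF F(1) \<sigma>] by simp
  then have n': "card (\<Union>F) = Suc (n - 1)" using cardW W_def by simp
  obtain G where G: "G d = F" "G (n - 1) = {W}"
    "\<forall>j\<in>{d..n - 1}. stacked_facets j (G j) \<and> \<Union>(free_ridges j (G j)) = W"
    "\<forall>j\<in>{d..<n - 1}. generated (free_ridges j (G j)) \<subseteq> generated (free_ridges (Suc j) (G (Suc j)))"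
    using stacked_facets_chain[OF F(1) assms(1) F(3) n'] unfolding W_def by blast
  \<comment> \<open>The chain is built on the natural numbers; \<open>g\<close> carries it back to
    the vertices of \<open>X\<close>.\<close>
  define g where "g = inv_into (vertices X) f"
  have g: "bij_betw g W (vertices X)" using bij_betw_inv_into[OF f(1)] by (simp add: g_def bd)
  then have inj: "inj_on g W" and gW: "g ` W = vertices X" by (auto simp: bij_betw_def)
  \<comment> \<open>The index is shifted because a \<open>j\<close>-sphere bounds a ball of
    dimension \<open>j + 1\<close>.\<close>
  define Y where "Y j = (`) g ` generated (free_ridges (Suc j) (G (Suc j)))" for j
  have "Y (d - 1) = (`) g ` (`) f ` X"
    using assms(1) G(1) F(2) f(2) by (simp add: Y_def)
  also have "\<dots> = X"
    using f(1) by (intro image_complex_inverse) (auto simp: g_def bij_betw_def)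
  finally have "Y (d - 1) = X" .
  moreover have "Y (n - 2) = standard_sphere (vertices X)"
  proof -
    have "Suc (n - 2) = n - 1" using n assms(1) by simp
    then have "Y (n - 2) = (`) g ` standard_sphere W"
      using G(2) generated_free_ridges_simplex[of W "n - 1"] n' by (simp add: Y_def W_def)
    then show ?thesis using standard_sphere_image[OF inj] gW by simp
  qed
  moreover have "stacked_sphere j (Y j) \<and> card (vertices (Y j)) = n" if "j \<in> {d - 1..n - 2}" for j
  proof -
    have "Suc j \<in> {d..n - 1}" using that n assms(1) by auto
    then have j: "stacked_facets (Suc j) (G (Suc j))" "\<Union>(free_ridges (Suc j) (G (Suc j))) = W"
      using G(3) by auto
    have "vertices (Y j) = vertices X"
      using j(2) gW by (simp add: Y_def vertices_image vertices_generated)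
    then show ?thesis using stacked_sphere_image[OF j(1)] j(2) inj assms(3) by (simp add: Y_def)
  qed
  moreover have "Y j \<subseteq> Y (j + 1)" if "j \<in> {d - 1..<n - 2}" for j
  proof -
    have "Suc j \<in> {d..<n - 1}" using that by auto
    then show ?thesis using G(4) by (auto simp: Y_def intro!: image_mono)
  qed
  ultimately show ?thesis using n assms(1) by (intro conjI exI[of _ Y]) auto
qed

end
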